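(* Let $d_n^{\#3}$ be the number of rows with the value true in the truth tables of all the bracketed m-implications with $n$ variables, type 1, case 3. Then, as $n\to\infty$, $$d_n^{\#3} \sim \left(\frac{11\sqrt{10}-30}{20}\right)\frac{2^{3n-2}}{\sqrt{\pi n^3}}.$$
   Context: The m-implication of type 1 is the connective $\psi\rightharpoonup\phi\equiv\psi\to\neg\phi$, which has value 0 (false) exactly when $\psi$ and $\phi$ both have value 1 (true), and value 1 otherwise. A bracketed formula with $n$ distinct variables is obtained from $p_1\rightharpoonup p_2\rightharpoonup\cdots\rightharpoonup p_n$ (variables in this fixed order) by fully inserting brackets; for $n\ge2$ it has the form $\psi\rightharpoonup\phi$ with $\psi$ a bracketing of $p_1\rightharpoonup\cdots\rightharpoonup p_i$ and $\phi$ a bracketing of $p_{i+1}\rightharpoonup\cdots\rightharpoonup p_n$ for some $1\le i\le n-1$. A row is a pair consisting of a bracketed formula and a valuation of $p_1,\dots,p_n$ in $\{0,1\}$. Case 3 means: for $n\ge2$, $d_n^{\#3}$ counts the rows (over all bracketed formulae in $n$ variables) for which $\psi$ has value 1 and $\phi$ has value 0 (so that $\psi\rightharpoonup\phi$ is true). $u_n\sim v_n$ means $u_n/v_n\to1$. *)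

theory Defs
  imports "HOL-Analysis.Analysis" "HOL-Library.Landau_Symbols"
begin

text \<open>The m-implication of type 1.\<close>

definition mimp :: "bool \<Rightarrow> bool \<Rightarrow> bool" where
  "mimp a b \<longleftrightarrow> (a \<longrightarrow> \<not> b)"

datatype form = Var nat | MImp form form

primrec form_vars :: "form \<Rightarrow> nat list" where
  "form_vars (Var i) = [i]"
| "form_vars (MImp \<psi> \<phi>) = form_vars \<psi> @ form_vars \<phi>"

primrec form_val :: "(nat \<Rightarrow> bool) \<Rightarrow> form \<Rightarrow> bool" where
  "form_val v (Var i) = v i"
| "form_val v (MImp \<psi> \<phi>) = mimp (form_val v \<psi>) (form_val v \<phi>)"

text \<open>A full bracketing of the chain of variables \<open>1, \<dots>, n\<close> is a binary formula tree whose
  leaves, read from left to right, are exactly these variables.\<close>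

definition bracketed :: "nat \<Rightarrow> form set" where
  "bracketed n = {\<theta>. form_vars \<theta> = [1..<Suc n]}"

text \<open>Valuations are extensional functions on \<open>{1..n}\<close>, so that there are exactly \<open>2 ^ n\<close> of
  them.\<close>

definition valuations :: "nat \<Rightarrow> (nat \<Rightarrow> bool) set" where
  "valuations n = {1..n} \<rightarrow>\<^sub>E UNIV"

definition rows :: "nat \<Rightarrow> (form \<times> (nat \<Rightarrow> bool)) set" where
  "rows n = bracketed n \<times> valuations n"

definition case3_rows :: "nat \<Rightarrow> (form \<times> (nat \<Rightarrow> bool)) set" where
  "case3_rows n =
    {(\<theta>, v) \<in> rows n. \<exists>\<psi> \<phi>. \<theta> = MImp \<psi> \<phi> \<and> form_val v \<psi> \<and> \<not> form_val v \<phi>}"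

definition d3 :: "nat \<Rightarrow> nat" where
  "d3 n = card (case3_rows n)"

text \<open>All the sets above are finite, so \<open>card\<close> really counts.\<close>

lemma form_vars_nonempty: "form_vars \<theta> \<noteq> []"
  by (induction \<theta>) auto

lemma finite_form_vars_eq: "finite {\<theta>. form_vars \<theta> = xs}"
proof (induction "length xs" arbitrary: xs rule: less_induct)
  case less
  let ?S = "\<lambda>ys. {\<theta>. form_vars \<theta> = ys}"
  let ?I = "{i. 0 < i \<and> i < length xs}"
  have "\<theta> \<in> Var ` set xs \<union>
      (\<Union>i\<in>?I. (\<lambda>(\<psi>, \<phi>). MImp \<psi> \<phi>) ` (?S (take i xs) \<times> ?S (drop i xs)))"
    if "form_vars \<theta> = xs" for \<theta>
  proof (cases \<theta>)
    case (Var i)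
    with that show ?thesis by auto
  next
    case (MImp \<psi> \<phi>)
    then have "xs = form_vars \<psi> @ form_vars \<phi>"
      using that by simp
    then have "length (form_vars \<psi>) \<in> ?I"
      "\<psi> \<in> ?S (take (length (form_vars \<psi>)) xs)" "\<phi> \<in> ?S (drop (length (form_vars \<psi>)) xs)"
      using form_vars_nonempty by auto
    with MImp show ?thesis by blast
  qed
  then have sub: "?S xs \<subseteq> Var ` set xs \<union>
      (\<Union>i\<in>?I. (\<lambda>(\<psi>, \<phi>). MImp \<psi> \<phi>) ` (?S (take i xs) \<times> ?S (drop i xs)))"
    by blast
  have "finite (?S (take i xs))" "finite (?S (drop i xs))" if "i \<in> ?I" for i
    using that by (auto intro!: less)
  then have "finite (Var ` set xs \<union>
      (\<Union>i\<in>?I. (\<lambda>(\<psi>, \<phi>). MImp \<psi> \<phi>) ` (?S (take i xs) \<times> ?S (drop i xs))))"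
    by (intro finite_UnI finite_UN_I finite_imageI finite_cartesian_product) auto
  with sub show ?case
    by (rule finite_subset)
qed

lemma finite_rows: "finite (rows n)"
  unfolding rows_def bracketed_def valuations_def
  by (intro finite_cartesian_product finite_form_vars_eq finite_PiE) auto

lemma finite_case3_rows: "finite (case3_rows n)"
  by (rule finite_subset[OF _ finite_rows[of n]]) (auto simp: case3_rows_def)

end

theory Submission
  imports Defs "HOL-Complex_Analysis.Complex_Analysis" "HOL-Real_Asymp.Real_Asymp"
begin

text \<open>
  Let \<open>T\<close> and \<open>F\<close> be the generating functions of the true and the false rows. Splitting a formula at
  its root gives \<open>F = x + T\<^sup>2\<close> and \<open>T = x + F\<^sup>2 + 2 T F\<close>, and case 3 has generating function \<open>T F\<close>.
  With \<open>S = 1 - 2 (T + F)\<close> one finds \<open>S\<^sup>2 = 1 - 8 x\<close> and \<open>(2 T + 1)\<^sup>2 = 3 - 4 x - 2 S\<close>. The latter nested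
  radical is denested as \<open>2 T + 1 = U - S / U\<close>, where
  \<open>U\<^sup>2 = (3 - 4 x + sqrt (5 + 8 x + 16 x\<^sup>2)) / 2\<close> no longer involves \<open>S\<close>, so that \<open>U\<close> and \<open>1 / U\<close> are analytic
  in a disc larger than the one of radius \<open>1 / 8\<close>. Hence \<open>4 T F = E + S O\<close> with \<open>E\<close> and \<open>O\<close> analytic there,
  and the coefficients of \<open>T F\<close> are asymptotically \<open>O (1 / 8) / 4\<close> times those of \<open>S\<close>.
\<close>

section \<open>Generating functions of the rows\<close>

text \<open>Arbitrary variable lists are allowed because the right half of a split chain does not
  start at variable 1.\<close>

definition val_rows :: "nat list \<Rightarrow> bool \<Rightarrow> (form \<times> (nat \<Rightarrow> bool)) set" where
  "val_rows xs b = {(\<theta>, v). form_vars \<theta> = xs \<and> v \<in> set xs \<rightarrow>\<^sub>E UNIV \<and> form_val v \<theta> = b}"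

text \<open>Over \<open>[1..<Suc n]\<close> with \<open>b = True\<close> and
  \<open>c = False\<close> these are exactly the rows of case 3.\<close>

definition split_rows :: "nat list \<Rightarrow> bool \<Rightarrow> bool \<Rightarrow> (form \<times> (nat \<Rightarrow> bool)) set" where
  "split_rows xs b c = {(\<theta>, v). form_vars \<theta> = xs \<and> v \<in> set xs \<rightarrow>\<^sub>E UNIV \<and>
     (\<exists>\<psi> \<phi>. \<theta> = MImp \<psi> \<phi> \<and> form_val v \<psi> = b \<and> form_val v \<phi> = c)}"

lemma finite_rows_over: "finite {(\<theta>, v). form_vars \<theta> = xs \<and> v \<in> set xs \<rightarrow>\<^sub>E (UNIV :: bool set)}"
proof -
  have "finite ({\<theta>. form_vars \<theta> = xs} \<times> (set xs \<rightarrow>\<^sub>E (UNIV :: bool set)))"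
    by (intro finite_cartesian_product finite_form_vars_eq finite_PiE) auto
  then show ?thesis
    by (rule finite_subset[rotated]) auto
qed

lemma finite_val_rows: "finite (val_rows xs b)"
  by (rule finite_subset[OF _ finite_rows_over[of xs]]) (auto simp: val_rows_def)

lemma finite_split_rows: "finite (split_rows xs b c)"
  by (rule finite_subset[OF _ finite_rows_over[of xs]]) (auto simp: split_rows_def)

lemma form_val_cong:
  "(\<And>i. i \<in> set (form_vars \<theta>) \<Longrightarrow> v i = w i) \<Longrightarrow> form_val v \<theta> = form_val w \<theta>"
  by (induction \<theta>) auto

text \<open>A row is cut at its root into two rows over the two halves of the chain. Distinctness
  makes the halves disjoint, so their valuations can be chosen independently. The end summands
  vanish, since no formula has an empty variable list; including them gives the sum the shape of a
  Cauchy product.\<close>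

lemma card_split_rows:
  assumes "distinct xs"
  shows "card (split_rows xs b c) =
    (\<Sum>i\<le>length xs. card (val_rows (take i xs) b) * card (val_rows (drop i xs) c))"
proof -
  define L where "L i = set (take i xs)" for i
  define R where "R i = set (drop i xs)" for i
  define f where "f = (\<lambda>(i, (\<psi>, v), (\<phi>, w)).
    (MImp \<psi> \<phi>, merge (L i) (R i) (v :: nat \<Rightarrow> bool, w)))"
  \<comment> \<open>The cut point is recovered as the number of leaves of the left subformula. The
    \<open>Var\<close> branch is a dummy, as the root of a split row is an implication.\<close>
  define g where "g = (\<lambda>(\<theta>, v :: nat \<Rightarrow> bool).
    case \<theta> of MImp \<psi> \<phi> \<Rightarrow> let i = length (form_vars \<psi>) in (i, (\<psi>, restrict v (L i)), (\<phi>, restrict v (R i)))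
      | Var j \<Rightarrow> undefined)"
  have disj: "L i \<inter> R i = {}" for i
    unfolding L_def R_def using assms set_take_disj_set_drop_if_distinct[of xs i i] by simp
  have un: "L i \<union> R i = set xs" for i
    unfolding L_def R_def by (metis append_take_drop_id set_append)
  let ?A = "SIGMA i:{..length xs}. val_rows (take i xs) b \<times> val_rows (drop i xs) c"
  have f: "f p \<in> split_rows xs b c \<and> g (f p) = p" if p: "p \<in> ?A" for p
  proof -
    obtain i \<psi> v \<phi> w where p_eq: "p = (i, (\<psi>, v), (\<phi>, w))"
      by (metis prod.exhaust)
    have i: "i \<le> length xs" and vars: "form_vars \<psi> = take i xs" "form_vars \<phi> = drop i xs"
      and v: "v \<in> L i \<rightarrow>\<^sub>E UNIV" "form_val v \<psi> = b" and w: "w \<in> R i \<rightarrow>\<^sub>E UNIV" "form_val w \<phi> = c"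
      using p by (auto simp: p_eq val_rows_def L_def R_def)
    let ?m = "merge (L i) (R i) (v, w)"
    have "form_val ?m \<psi> = form_val v \<psi>"
      by (rule form_val_cong) (simp add: vars merge_def L_def)
    moreover have "form_val ?m \<phi> = form_val w \<phi>"
      by (rule form_val_cong) (use disj[of i] in \<open>auto simp: vars merge_def R_def\<close>)
    moreover have "?m \<in> set xs \<rightarrow>\<^sub>E UNIV"
      using disj[of i] by (simp flip: un[of i])
    ultimately have "f p \<in> split_rows xs b c"
      using v w by (auto simp: p_eq f_def split_rows_def vars)
    moreover have "restrict ?m (L i) = v" "restrict ?m (R i) = w"
      using v w disj[of i] by (auto simp: PiE_restrict)
    then have "g (f p) = p"
      using i by (simp add: p_eq f_def g_def vars Let_def)
    ultimately show ?thesis by blast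
  qed
  have g: "g q \<in> ?A \<and> f (g q) = q" if q: "q \<in> split_rows xs b c" for q
  proof -
    obtain \<psi> \<phi> v where q_eq: "q = (MImp \<psi> \<phi>, v)" and xs: "form_vars \<psi> @ form_vars \<phi> = xs"
      and v: "v \<in> set xs \<rightarrow>\<^sub>E UNIV" "form_val v \<psi> = b" "form_val v \<phi> = c"
      using q by (auto simp: split_rows_def)
    define i where "i = length (form_vars \<psi>)"
    have vars: "take i xs = form_vars \<psi>" "drop i xs = form_vars \<phi>" and i: "i \<le> length xs"
      by (auto simp: i_def simp flip: xs)
    have "form_val (restrict v (L i)) \<psi> = form_val v \<psi>"
      by (rule form_val_cong) (simp add: L_def vars)
    moreover have "form_val (restrict v (R i)) \<phi> = form_val v \<phi>"
      by (rule form_val_cong) (simp add: R_def vars)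
    ultimately have "g q \<in> ?A"
      using i v by (auto simp: q_eq g_def Let_def val_rows_def vars L_def R_def simp flip: i_def)
    \<comment> \<open>Outside \<open>L i \<union> R i\<close> both sides are
      \<open>undefined\<close>, because \<open>v\<close> is extensional on
      \<open>set xs\<close>.\<close>
    moreover have "merge (L i) (R i) (restrict v (L i), restrict v (R i)) = v"
      using v(1) un[of i] by (auto simp: merge_def fun_eq_iff PiE_def extensional_def)
    then have "f (g q) = q"
      by (simp add: q_eq g_def f_def Let_def flip: i_def)
    ultimately show ?thesis by blast
  qed
  have "bij_betw f ?A (split_rows xs b c)"
    by (rule bij_betw_byWitness[where f' = g]) (use f g in blast)+
  then have "card (split_rows xs b c) = card ?A"
    by (simp add: bij_betw_same_card)
  also have "\<dots> = (\<Sum>i\<le>length xs. card (val_rows (take i xs) b) * card (val_rows (drop i xs) c))"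
    by (subst card_SigmaI) (auto simp: finite_val_rows card_cartesian_product)
  finally show ?thesis .
qed

text \<open>Rows are classified by the root. A single variable takes the value \<open>b\<close>
  under exactly one valuation; any other row lies in exactly one \<open>split_rows xs c d\<close>
  whose values combine to \<open>b\<close>.\<close>

lemma card_val_rows:
  "card (val_rows xs b) = (if length xs = 1 then 1 else 0) +
    (\<Sum>(c, d)\<in>{(c, d). mimp c d = b}. card (split_rows xs c d))"
proof -
  define V where "V = {(\<theta>, v). (\<exists>i. \<theta> = Var i) \<and> (\<theta>, v) \<in> val_rows xs b}"
  let ?P = "{(c, d). mimp c d = b}"
  have V: "card V = (if length xs = 1 then 1 else 0)"
  proof (cases "length xs = 1")
    case True
    then obtain i where xs: "xs = [i]"
      by (auto simp: length_Suc_conv)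
    have "V = {(Var i, \<lambda>j\<in>{i}. b)}"
      by (auto simp: V_def val_rows_def xs PiE_iff extensional_def fun_eq_iff)
    with True show ?thesis by simp
  next
    case False
    then have "V = {}"
      by (auto simp: V_def val_rows_def)
    with False show ?thesis by simp
  qed
  have "val_rows xs b = V \<union> (\<Union>(c, d)\<in>?P. split_rows xs c d)"
  proof (intro set_eqI iffI)
    fix p assume p: "p \<in> val_rows xs b"
    obtain \<theta> v where [simp]: "p = (\<theta>, v)" by fastforce
    show "p \<in> V \<union> (\<Union>(c, d)\<in>?P. split_rows xs c d)"
      using p by (cases \<theta>) (auto simp: V_def val_rows_def split_rows_def)
  qed (auto simp: V_def val_rows_def split_rows_def)
  moreover have "card (V \<union> (\<Union>(c, d)\<in>?P. split_rows xs c d)) = card V + card (\<Union>(c, d)\<in>?P. split_rows xs c d)"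
  proof (rule card_Un_disjoint)
    show "finite V"
      by (rule finite_subset[OF _ finite_val_rows[of xs b]]) (auto simp: V_def)
    show "finite (\<Union>(c, d)\<in>?P. split_rows xs c d)"
      by (auto simp: finite_split_rows)
  qed (auto simp: V_def split_rows_def)
  moreover have "card (\<Union>(c, d)\<in>?P. split_rows xs c d) = (\<Sum>(c, d)\<in>?P. card (split_rows xs c d))"
    by (subst card_UN_disjoint) (auto simp: finite_split_rows case_prod_unfold, auto simp: split_rows_def)
  ultimately show ?thesis
    using V by simp
qed

text \<open>Variables enter the recursion only through the length of the list, so strong induction
  replaces an explicit renaming bijection.\<close>

lemma card_val_rows_cong:
  assumes "distinct xs" "distinct ys" "length xs = length ys"
  shows "card (val_rows xs b) = card (val_rows ys b)"
  using assms
proof (induction "length xs" arbitrary: xs ys b rule: less_induct)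
  case less
  have empty: "val_rows [] c = {}" for c
    by (auto simp: val_rows_def form_vars_nonempty)
  have "card (split_rows xs c d) = card (split_rows ys c d)" for c d
    unfolding card_split_rows[OF less.prems(1)] card_split_rows[OF less.prems(2)]
  proof (rule sum.cong)
    fix i assume "i \<in> {..length ys}"
    \<comment> \<open>At both ends one half is the whole list, to which the induction hypothesis
      does not apply, but the other half is empty and makes the product zero.\<close>
    then consider "i = 0" | "i = length ys" | "0 < i" "i < length ys" by fastforce
    then show "card (val_rows (take i xs) c) * card (val_rows (drop i xs) d) =
        card (val_rows (take i ys) c) * card (val_rows (drop i ys) d)"
    proof cases
      case 3
      then show ?thesis
        using less.prems by (intro arg_cong2[where f = "(*)"] less.hyps) auto
    qed (use less.prems empty in auto)
  qed (use less.prems in auto)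
  then show ?case
    by (simp add: card_val_rows[of xs] card_val_rows[of ys] less.prems(3))
qed

definition row_count :: "bool \<Rightarrow> nat \<Rightarrow> nat" where
  "row_count b n = card (val_rows [1..<Suc n] b)"

lemma card_val_rows_eq: "distinct xs \<Longrightarrow> card (val_rows xs b) = row_count b (length xs)"
  unfolding row_count_def by (rule card_val_rows_cong) (simp_all del: upt_Suc)

lemma card_split_rows_eq:
  "card (split_rows [1..<Suc n] b c) = (\<Sum>i=0..n. row_count b i * row_count c (n - i))"
  by (subst card_split_rows)
     (auto simp: card_val_rows_eq atMost_atLeast0 simp del: upt_Suc intro!: sum.cong)

lemma row_count_rec:
  "row_count b n = (if n = 1 then 1 else 0) +
    (\<Sum>(c, d)\<in>{(c, d). mimp c d = b}. \<Sum>i=0..n. row_count c i * row_count d (n - i))"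
  by (subst row_count_def) (simp add: card_val_rows card_split_rows_eq del: upt_Suc One_nat_def)

lemma d3_eq: "d3 n = (\<Sum>i=0..n. row_count True i * row_count False (n - i))"
proof -
  have "case3_rows n = split_rows [1..<Suc n] True False"
    by (auto simp: case3_rows_def rows_def bracketed_def valuations_def split_rows_def
        atLeastLessThanSuc_atLeastAtMost simp del: upt_Suc)
  then show ?thesis
    by (simp only: d3_def card_split_rows_eq)
qed

lemma row_count_0: "row_count b 0 = 0"
proof -
  have "val_rows [] b = {}"
    by (auto simp: val_rows_def form_vars_nonempty)
  then show ?thesis by (simp add: row_count_def)
qed

section \<open>Functional equations for the generating functions\<close>

text \<open>These are \<open>F\<close> and \<open>T\<close>, with complex coefficients so that they
  can be compared with Taylor series of holomorphic functions.\<close>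

definition row_fps :: "bool \<Rightarrow> complex fps" where
  "row_fps b = Abs_fps (\<lambda>n. of_nat (row_count b n))"

lemma row_fps_False: "row_fps False = fps_X + row_fps True ^ 2"
proof (rule fps_ext)
  fix n
  have "{(c, d). mimp c d = False} = {(True, True)}"
    by (auto simp: mimp_def)
  then have "row_count False n =
      (if n = 1 then 1 else 0) + (\<Sum>i=0..n. row_count True i * row_count True (n - i))"
    by (subst row_count_rec) (simp only:, simp)
  then show "fps_nth (row_fps False) n = fps_nth (fps_X + row_fps True ^ 2) n"
    by (simp add: row_fps_def fps_mult_nth power2_eq_square fps_X_def)
qed

lemma row_fps_True: "row_fps True = fps_X + row_fps False ^ 2 + 2 * row_fps True * row_fps False"
proof -
  have "row_fps True = fps_X + (row_fps True * row_fps False +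
      (row_fps False * row_fps True + row_fps False * row_fps False))"
  proof (rule fps_ext)
    fix n
    have "{(c, d). mimp c d = True} = {(True, False), (False, True), (False, False)}"
      by (auto simp: mimp_def)
    then have "row_count True n = (if n = 1 then 1 else 0) +
        ((\<Sum>i=0..n. row_count True i * row_count False (n - i)) +
        ((\<Sum>i=0..n. row_count False i * row_count True (n - i)) +
         (\<Sum>i=0..n. row_count False i * row_count False (n - i))))"
      by (subst row_count_rec) (simp only:, simp)
    then show "fps_nth (row_fps True) n = fps_nth (fps_X + (row_fps True * row_fps False +
      (row_fps False * row_fps True + row_fps False * row_fps False))) n"
      unfolding fps_add_nth fps_mult_nth by (simp add: row_fps_def fps_X_def)
  qed
  then show ?thesis
    by (simp add: power2_eq_square algebra_simps)
qed

lemma d3_fps: "row_fps True * row_fps False = Abs_fps (\<lambda>n. of_nat (d3 n))"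
  by (simp add: fps_eq_iff row_fps_def fps_mult_nth d3_eq)

section \<open>Coefficients of products of power series\<close>

text \<open>Since \<open>norm L * z > 1\<close>, the sequence \<open>norm (a n) * z ^ n\<close> is
  eventually increasing, so its last term dominates all earlier ones up to a constant that absorbs a
  finite initial segment.\<close>

lemma ratio_limit_dominates:
  fixes a :: "nat \<Rightarrow> 'a :: real_normed_field"
  assumes nz: "\<And>n. a n \<noteq> 0" and ratio: "(\<lambda>n. a (Suc n) / a n) \<longlonglongrightarrow> L"
    and z: "norm L * z > 1" "z > 0"
  obtains K where "K > 0" "\<forall>\<^sub>F n in sequentially. \<forall>m\<le>n. norm (a m) * z ^ m \<le> K * (norm (a n) * z ^ n)"
proof -
  define q where "q n = norm (a n) * z ^ n" for n
  have q: "q n > 0" for n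
    using nz z by (simp add: q_def)
  have "(\<lambda>n. norm (a (Suc n) / a n) * z) \<longlonglongrightarrow> norm L * z"
    by (intro tendsto_intros ratio)
  then have "\<forall>\<^sub>F n in sequentially. norm (a (Suc n) / a n) * z > 1"
    using z(1) by (rule order_tendstoD)
  then obtain N where N: "\<And>n. n \<ge> N \<Longrightarrow> norm (a (Suc n) / a n) * z > 1"
    by (auto simp: eventually_sequentially)
  have step: "q n \<le> q (Suc n)" if "n \<ge> N" for n
  proof -
    have "q n * 1 \<le> q n * (norm (a (Suc n) / a n) * z)"
      using N[OF that] q[of n] by (intro mult_left_mono) auto
    also have "\<dots> = q (Suc n)"
      using nz[of n] by (simp add: q_def norm_divide)
    finally show ?thesis by simp
  qed
  have mono: "q m \<le> q n" if "N \<le> m" "m \<le> n" for m n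
    using that(2,1) by (induction rule: dec_induct) (auto intro: order.trans step)
  \<comment> \<open>This makes \<open>K * q N\<close> the sum over the initial segment, which bounds
    every early term. The sum contains \<open>q N\<close>, so \<open>K \<ge> 1\<close>, which
    handles the late terms.\<close>
  define K where "K = (\<Sum>m\<le>N. q m) / q N"
  have "(\<Sum>m\<le>N. q m) \<ge> q N"
    using q by (intro member_le_sum) (auto intro: less_imp_le)
  then have K: "K \<ge> 1"
    using q[of N] by (simp add: K_def)
  have "q m \<le> K * q n" if n: "n \<ge> N" and m: "m \<le> n" for m n
  proof (cases "m \<le> N")
    case True
    have "q m \<le> (\<Sum>m\<le>N. q m)"
      using q True by (intro member_le_sum) (auto intro: less_imp_le)
    also have "\<dots> = K * q N"
      using q[of N] by (simp add: K_def)
    also have "\<dots> \<le> K * q n"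
      using K n by (intro mult_left_mono mono) auto
    finally show ?thesis .
  next
    case False
    then have "q m \<le> 1 * q n"
      using m by (simp add: mono)
    also have "\<dots> \<le> K * q n"
      using K q[of n] by (intro mult_right_mono) auto
    finally show ?thesis .
  qed
  then have "\<forall>\<^sub>F n in sequentially. \<forall>m\<le>n. q m \<le> K * q n"
    by (auto simp: eventually_sequentially)
  with K show ?thesis
    by (intro that[of K]) (auto simp: q_def)
qed

text \<open>A ratio limit \<open>L\<close> corresponds to radius of convergence
  \<open>1 / norm L\<close>. The chosen \<open>z\<close> lies beyond that radius but still inside
  the disc of convergence of \<open>b\<close>.\<close>

lemma conv_radius_gt_ratioE:
  fixes L :: "'a :: real_normed_field"
  assumes "L \<noteq> 0" "fps_conv_radius b > ereal (1 / norm L)"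
  obtains z where "z > 0" "norm L * z > 1" "ereal z < fps_conv_radius b"
proof -
  obtain z where z: "ereal (1 / norm L) < ereal z" "ereal z < fps_conv_radius b"
    using ereal_dense2[OF assms(2)] by blast
  then have "z > 1 / norm L" by simp
  moreover have "1 / norm L > 0"
    using assms(1) by simp
  ultimately have "z > 0" by (rule less_trans[rotated])
  moreover have "norm L * z > 1"
    using \<open>z > 1 / norm L\<close> assms(1) by (simp add: field_simps)
  ultimately show ?thesis
    using z(2) by (intro that)
qed

text \<open>The domination bound at \<open>m = 0\<close> gives
  \<open>1 / norm (fps_nth a n) \<le> K * z ^ n / norm (fps_nth a 0)\<close> for large
  \<open>n\<close>, and \<open>norm (fps_nth b n) * z ^ n\<close> is the term of a convergent
  series.\<close>

lemma fps_nth_over_ratio_tendsto_0: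
  fixes a b :: "'a :: {banach, real_normed_field} fps"
  assumes nz: "\<And>n. fps_nth a n \<noteq> 0" and ratio: "(\<lambda>n. fps_nth a (Suc n) / fps_nth a n) \<longlonglongrightarrow> L"
    and L: "L \<noteq> 0" and radius: "fps_conv_radius b > ereal (1 / norm L)"
  shows "(\<lambda>n. fps_nth b n / fps_nth a n) \<longlonglongrightarrow> 0"
proof -
  obtain z where z: "z > 0" "norm L * z > 1" "ereal z < fps_conv_radius b"
    using conv_radius_gt_ratioE[OF L radius] .
  obtain K where K: "K > 0"
    "\<forall>\<^sub>F n in sequentially. \<forall>m\<le>n. norm (fps_nth a m) * z ^ m \<le> K * (norm (fps_nth a n) * z ^ n)"
    using ratio_limit_dominates[OF nz ratio z(2,1)] .
  let ?c = "norm (fps_nth a 0)"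
  have c: "?c > 0" using nz by simp
  have "summable (\<lambda>n. norm (fps_nth b n * of_real z ^ n))"
    by (rule norm_summable_fps) (use z in auto)
  then have "(\<lambda>n. K / ?c * norm (fps_nth b n * of_real z ^ n)) \<longlonglongrightarrow> K / ?c * 0"
    by (intro tendsto_intros summable_LIMSEQ_zero)
  then have lim: "(\<lambda>n. K / ?c * norm (fps_nth b n * of_real z ^ n)) \<longlonglongrightarrow> 0" by simp
  have "\<forall>\<^sub>F n in sequentially. norm (fps_nth b n / fps_nth a n) \<le> K / ?c * norm (fps_nth b n * of_real z ^ n)"
    using K(2)
  proof eventually_elim
    case (elim n)
    then have "?c * z ^ 0 \<le> K * (norm (fps_nth a n) * z ^ n)" by blast
    then have "norm (fps_nth b n) * ?c \<le> norm (fps_nth b n) * (K * (norm (fps_nth a n) * z ^ n))"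
      by (intro mult_left_mono) auto
    then show ?case
      using c nz[of n] z by (simp add: norm_divide norm_mult norm_power field_simps)
  qed
  from Lim_null_comparison[OF this lim] show ?thesis .
qed

text \<open>Bender's theorem on the coefficients of a product with a factor of larger radius of
  convergence, by dominated convergence.\<close>

lemma fps_mult_ratio_tendsto:
  fixes a b :: "'a :: {banach, real_normed_field} fps"
  assumes nz: "\<And>n. fps_nth a n \<noteq> 0" and ratio: "(\<lambda>n. fps_nth a (Suc n) / fps_nth a n) \<longlonglongrightarrow> L"
    and L: "L \<noteq> 0" and radius: "fps_conv_radius b > ereal (1 / norm L)"
  shows "(\<lambda>n. fps_nth (a * b) n / fps_nth a n) \<longlonglongrightarrow> eval_fps b (1 / L)"
proof -
  obtain z where z: "z > 0" "norm L * z > 1" "ereal z < fps_conv_radius b"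
    using conv_radius_gt_ratioE[OF L radius] .
  obtain K where K: "K > 0"
    "\<forall>\<^sub>F n in sequentially. \<forall>m\<le>n. norm (fps_nth a m) * z ^ m \<le> K * (norm (fps_nth a n) * z ^ n)"
    using ratio_limit_dominates[OF nz ratio z(2,1)] .
  \<comment> \<open>The normalised Cauchy product is extended by zero to all \<open>k\<close>,
    turning it into an infinite series whose limit in \<open>n\<close> can be taken
    termwise.\<close>
  define f where "f k n = (if k \<le> n then fps_nth b k * fps_nth a (n - k) / fps_nth a n else 0)" for k n
  have lim1: "(\<lambda>n. fps_nth a n / fps_nth a (n + k)) \<longlonglongrightarrow> (1 / L) ^ k" for k
  proof (induction k)
    case (Suc k)
    have "(\<lambda>n. fps_nth a (n + k) / fps_nth a (Suc (n + k))) \<longlonglongrightarrow> 1 / L"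
      using LIMSEQ_ignore_initial_segment[OF tendsto_inverse[OF ratio L], of k] by (simp add: inverse_eq_divide)
    from tendsto_mult[OF this Suc.IH] show ?case
      using nz by simp
  qed (use nz in simp)
  have lim: "f k \<longlonglongrightarrow> fps_nth b k * (1 / L) ^ k" for k
  proof -
    \<comment> \<open>Shifting the index by \<open>k\<close> keeps it in the range where
      \<open>f\<close> is the genuine quotient.\<close>
    have "(\<lambda>n. f k (n + k)) \<longlonglongrightarrow> fps_nth b k * (1 / L) ^ k"
      using tendsto_mult[OF tendsto_const lim1[of k], of "fps_nth b k"] by (simp add: f_def)
    then show ?thesis
      by (rule LIMSEQ_offset)
  qed
  have bound: "\<forall>\<^sub>F (k, n) in at_top \<times>\<^sub>F sequentially. norm (f k n) \<le> K * norm (fps_nth b k * of_real z ^ k)"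
  proof -
    have "norm (f k n) \<le> K * norm (fps_nth b k * of_real z ^ k)"
      if "\<forall>m\<le>n. norm (fps_nth a m) * z ^ m \<le> K * (norm (fps_nth a n) * z ^ n)" for k n
    proof (cases "k \<le> n")
      case True
      have "norm (fps_nth a (n - k)) * z ^ (n - k) \<le> K * (norm (fps_nth a n) * z ^ n)"
        using that by simp
      also have "z ^ n = z ^ (n - k) * z ^ k"
        using True by (simp flip: power_add)
      finally have "norm (fps_nth a (n - k)) \<le> K * (norm (fps_nth a n) * z ^ k)"
        using z by simp
      then have "norm (fps_nth b k) * norm (fps_nth a (n - k)) \<le>
          norm (fps_nth b k) * (K * (norm (fps_nth a n) * z ^ k))"
        by (intro mult_left_mono) auto
      then show ?thesis
        using True nz[of n] z by (simp add: f_def norm_divide norm_mult norm_power field_simps)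
    qed (use K in \<open>simp add: f_def\<close>)
    then have "\<forall>\<^sub>F n in sequentially. \<forall>k. norm (f k n) \<le> K * norm (fps_nth b k * of_real z ^ k)"
      by (intro eventually_mono[OF K(2)]) blast
    then show ?thesis
      unfolding eventually_prod_filter
      by (intro exI[of _ "\<lambda>_. True"] exI[of _ "\<lambda>n. \<forall>k. norm (f k n) \<le> K * norm (fps_nth b k * of_real z ^ k)"]) auto
  qed
  have "summable (\<lambda>k. norm (fps_nth b k * of_real z ^ k))"
    by (rule norm_summable_fps) (use z in auto)
  then have "summable (\<lambda>k. K * norm (fps_nth b k * of_real z ^ k))"
    by (rule summable_mult)
  from tannerys_theorem[OF lim bound this]
  have "(\<lambda>n. suminf (\<lambda>k. f k n)) \<longlonglongrightarrow> suminf (\<lambda>k. fps_nth b k * (1 / L) ^ k)"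
    by simp
  also have "(\<lambda>n. suminf (\<lambda>k. f k n)) = (\<lambda>n. fps_nth (a * b) n / fps_nth a n)"
  proof
    fix n
    have "suminf (\<lambda>k. f k n) = (\<Sum>k\<in>{0..n}. f k n)"
      by (rule suminf_finite) (auto simp: f_def)
    also have "\<dots> = fps_nth (b * a) n / fps_nth a n"
      by (simp add: f_def fps_mult_nth sum_divide_distrib)
    finally show "suminf (\<lambda>k. f k n) = fps_nth (a * b) n / fps_nth a n"
      by (simp add: mult.commute)
  qed
  finally show ?thesis
    by (simp add: eval_fps_def)
qed

section \<open>The power series of a square root\<close>

lemma Suc_gbinomial:
  fixes a :: "'a :: field_char_0"
  shows "of_nat (Suc n) * (a gchoose Suc n) = (a - of_nat n) * (a gchoose n)"
  using gbinomial_mult_1[of a n] by (simp add: algebra_simps)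

text \<open>A factor \<open>1 / 2 - n\<close> never vanishes, since \<open>2 * n\<close> is even.
  This justifies dividing by the coefficients of the square root.\<close>

lemma half_gbinomial_nonzero: "(1 / 2 gchoose n) \<noteq> (0 :: 'a :: field_char_0)"
proof (induction n)
  case (Suc n)
  have "(of_nat (2 * n) :: 'a) \<noteq> of_nat 1"
    unfolding of_nat_eq_iff by presburger
  then have "1 / 2 - of_nat n \<noteq> (0 :: 'a)"
    by (auto simp: field_simps)
  then show ?case
    using Suc Suc_gbinomial[of n "1 / 2 :: 'a"] by auto
qed simp

text \<open>Differentiating the square and multiplying by \<open>S\<close> yields
  \<open>2 (1 - c X) S' = - c S\<close>. Its coefficients satisfy the same first-order recurrence as
  the right-hand side, and \<open>S0\<close> fixes the initial value.\<close>

lemma fps_sqrt_linear_nth: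
  fixes S :: "'a :: field_char_0 fps"
  assumes S2: "S ^ 2 = 1 - fps_const c * fps_X" and S0: "fps_nth S 0 = 1"
  shows "fps_nth S n = (1 / 2 gchoose n) * (- c) ^ n"
proof (induction n)
  case (Suc n)
  have "2 * (S * fps_deriv S) = fps_deriv (S ^ 2)"
    by (simp add: power2_eq_square algebra_simps)
  also have "\<dots> = - fps_const c"
    by (simp add: S2)
  finally have "2 * (S * fps_deriv S) * S = - fps_const c * S" by simp
  then have "2 * (S ^ 2 * fps_deriv S) = - fps_const c * S"
    by (simp add: power2_eq_square algebra_simps)
  then have "2 * (fps_deriv S - fps_const c * (fps_X * fps_deriv S)) = - fps_const c * S"
    by (simp add: S2 algebra_simps)
  then have "fps_nth (2 * (fps_deriv S - fps_const c * (fps_X * fps_deriv S))) n = fps_nth (- fps_const c * S) n"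
    by simp
  then have eq: "2 * (of_nat (Suc n) * fps_nth S (Suc n)) = (2 * of_nat n - 1) * c * fps_nth S n"
    by (cases n) (simp_all add: algebra_simps fps_numeral_simps numeral_fps_const)
  have "2 * of_nat (Suc n) * fps_nth S (Suc n) =
      2 * of_nat (Suc n) * ((1 / 2 gchoose Suc n) * (- c) ^ Suc n)"
  proof -
    have "2 * of_nat (Suc n) * ((1 / 2 gchoose Suc n) * (- c) ^ Suc n) =
        (of_nat (Suc n) * (1 / 2 gchoose Suc n)) * (2 * (- c) ^ Suc n)"
      by (simp only: mult_ac)
    also have "\<dots> = (2 * of_nat n - 1) * c * ((1 / 2 gchoose n) * (- c) ^ n)"
      unfolding Suc_gbinomial by (simp add: algebra_simps)
    finally show ?thesis
      using eq by (simp only: Suc.IH mult.assoc)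
  qed
  then show ?case
    by (metis mult_cancel_left mult_eq_0_iff of_nat_neq_0 zero_neq_numeral)
qed (simp add: S0)

text \<open>The general asymptotics of binomial coefficients has the constant
  \<open>1 / Gamma (- a)\<close>. Here \<open>a = 1 / 2\<close>, and \<open>Gamma (- 1 / 2)\<close>
  follows from \<open>Gamma (1 / 2) = sqrt pi\<close> by the functional equation. The sign
  \<open>(- 1) ^ n\<close> is cancelled by \<open>(- 8) ^ n\<close>.\<close>

lemma half_gchoose_asymp:
  "(\<lambda>n. (1 / 2 gchoose n) * (- 8) ^ n / (8 ^ n / sqrt (real n ^ 3))) \<longlonglongrightarrow> - 1 / (2 * sqrt pi)"
proof -
  have "Gamma (- (1 / 2) + 1) = - (1 / 2) * Gamma (- (1 / 2) :: real)"
    by (rule Gamma_plus1) auto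
  then have Gamma: "Gamma (- (1 / 2) :: real) = - 2 * sqrt pi"
    by (simp add: Gamma_one_half_real)
  have "(\<lambda>n. (1 / 2 gchoose n) / ((- 1) ^ n / exp ((1 / 2 + 1) * ln (real n)))) \<longlonglongrightarrow> inverse (Gamma (- (1 / 2)))"
    using gbinomial_asymptotic[of "1 / 2 :: real"] by simp
  moreover have "\<forall>\<^sub>F n in sequentially. (1 / 2 gchoose n) / ((- 1) ^ n / exp ((1 / 2 + 1) * ln (real n))) =
      (1 / 2 gchoose n) * (- 8) ^ n / (8 ^ n / sqrt (real n ^ 3))"
    using eventually_gt_at_top[of 0]
  proof eventually_elim
    case (elim n)
    have "exp ((1 / 2 + 1) * ln (real n)) = real n powr (3 / 2)"
      using elim by (simp add: powr_def)
    also have "\<dots> = sqrt (real n ^ 3)"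
      using elim by (simp add: powr_half_sqrt[symmetric] powr_powr flip: powr_numeral)
    finally show ?case
      by (simp add: power_minus[of 8] divide_simps)
  qed
  ultimately have "(\<lambda>n. (1 / 2 gchoose n) * (- 8) ^ n / (8 ^ n / sqrt (real n ^ 3))) \<longlonglongrightarrow> inverse (Gamma (- (1 / 2)))"
    by (rule Lim_transform_eventually)
  then show ?thesis
    by (simp add: Gamma inverse_eq_divide)
qed

section \<open>Denesting the radical\<close>

text \<open>The ansatz \<open>2 T + 1 = U - S / U\<close> requires
  \<open>U^2 + (1 - 8 x) / U^2 = 3 - 4 x\<close>, a quadratic equation for \<open>U^2\<close> with
  discriminant \<open>5 + 8 x + 16 x^2\<close>. The plus sign before the inner root keeps
  \<open>U\<close> away from zero, also at \<open>x = 1 / 8\<close>.\<close>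

definition usqrt :: "complex \<Rightarrow> complex" where
  "usqrt x = csqrt ((3 - 4 * x + csqrt (5 + 8 * x + 16 * x ^ 2)) / 2)"

text \<open>Both radicands stay in the right half-plane, off the branch cut of \<open>csqrt\<close>:
  \<open>8 x + 16 x^2\<close> has norm below \<open>2 + 1\<close>, and \<open>3 - 4 x\<close> has
  real part above \<open>2\<close>.\<close>

lemma usqrt_args:
  assumes "norm x < 1 / 4"
  shows "Re (5 + 8 * x + 16 * x ^ 2) > 0" "Re ((3 - 4 * x + csqrt (5 + 8 * x + 16 * x ^ 2)) / 2) > 0"
proof -
  have "norm x ^ 2 < (1 / 4) ^ 2"
    using assms by (intro power_strict_mono) auto
  then have "norm (8 * x + 16 * x ^ 2) < 5"
    using assms norm_triangle_ineq[of "8 * x" "16 * x ^ 2"]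
    by (simp add: norm_mult norm_power power2_eq_square)
  then show "Re (5 + 8 * x + 16 * x ^ 2) > 0"
    using abs_Re_le_cmod[of "8 * x + 16 * x ^ 2"] by simp
  have "Re (csqrt (5 + 8 * x + 16 * x ^ 2)) \<ge> 0"
    by (rule Re_csqrt)
  moreover have "\<bar>Re x\<bar> < 1 / 4"
    using assms abs_Re_le_cmod[of x] by linarith
  ultimately show "Re ((3 - 4 * x + csqrt (5 + 8 * x + 16 * x ^ 2)) / 2) > 0"
    by (simp del: csqrt.sel)
qed

lemma usqrt_nonzero: "norm x < 1 / 4 \<Longrightarrow> usqrt x \<noteq> 0"
  using usqrt_args(2)[of x] unfolding usqrt_def by (metis csqrt_eq_0 less_irrefl zero_complex.sel(1))

lemma usqrt_holomorphic: "usqrt holomorphic_on eball 0 (ereal (1 / 4))"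
proof -
  have "z \<notin> \<real>\<^sub>\<le>\<^sub>0" if "Re z > 0" for z
    using that by (auto simp: complex_nonpos_Reals_iff)
  then show ?thesis
    unfolding usqrt_def[abs_def] using usqrt_args by (intro holomorphic_intros) auto
qed

text \<open>This is the quadratic equation for \<open>U^2\<close>, cleared of denominators.\<close>

lemma usqrt_quartic: "usqrt x ^ 4 + (1 - 8 * x) = (3 - 4 * x) * usqrt x ^ 2"
proof -
  define R where "R = csqrt (5 + 8 * x + 16 * x ^ 2)"
  have R: "R ^ 2 = 5 + 8 * x + 16 * x ^ 2"
    by (simp add: R_def)
  have u: "usqrt x ^ 2 = (3 - 4 * x + R) / 2"
    by (simp add: usqrt_def R_def)
  have "usqrt x ^ 4 = ((3 - 4 * x + R) / 2) ^ 2"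
    by (simp flip: u power_mult)
  also have "\<dots> = (9 - 24 * x + 16 * x ^ 2 + 2 * (3 - 4 * x) * R + R ^ 2) / 4"
    by (simp add: field_simps power2_eq_square)
  finally have u4: "usqrt x ^ 4 = (9 - 24 * x + 16 * x ^ 2 + 2 * (3 - 4 * x) * R + R ^ 2) / 4" .
  show ?thesis
    unfolding u4 u R by (simp add: field_simps power2_eq_square)
qed

text \<open>The bound on the value at 0 later decides the sign of the square root
  \<open>2 T + 1\<close>.\<close>

lemma usqrt_0: obtains r :: real where "r > 1" "usqrt 0 = of_real r"
proof
  have "csqrt 5 = of_real (sqrt 5)"
    using of_real_sqrt[of 5] by simp
  then have "usqrt 0 = csqrt (of_real ((3 + sqrt 5) / 2))"
    by (simp add: usqrt_def)
  also have "\<dots> = of_real (sqrt ((3 + sqrt 5) / 2))"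
    by (rule of_real_sqrt[symmetric]) auto
  finally show "usqrt 0 = of_real (sqrt ((3 + sqrt 5) / 2))" .
  show "sqrt ((3 + sqrt 5) / 2) > 1"
    by (simp add: add_pos_pos)
qed

text \<open>At the singularity the inner radicand is the perfect square \<open>25 / 4\<close>, so
  \<open>U^2 = 5 / 2\<close>; this is the source of \<open>sqrt 10\<close> in the final
  constant.\<close>

lemma usqrt_eighth: "usqrt (1 / 8) = of_real (sqrt 10 / 2)"
proof -
  have "csqrt (25 / 4) = of_real (sqrt (25 / 4))"
    by simp
  also have "sqrt (25 / 4) = 5 / 2"
    by (rule real_sqrt_unique) (auto simp: power2_eq_square)
  finally have R: "csqrt (25 / 4) = 5 / 2"
    by simp
  have "usqrt (1 / 8) = csqrt ((3 - 4 * (1 / 8) + csqrt (25 / 4)) / 2)"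
    by (simp add: usqrt_def power2_eq_square del: csqrt_of_real_nonneg)
  also have "\<dots> = csqrt (of_real (5 / 2))"
    by (subst R) simp
  also have "\<dots> = of_real (sqrt (5 / 2))"
    by (rule of_real_sqrt[symmetric]) auto
  also have "sqrt (5 / 2) = sqrt 10 / 2"
    by (rule real_sqrt_unique) (auto simp: power_divide)
  finally show ?thesis .
qed

section \<open>Asymptotics\<close>

text \<open>All analytic information is packed into formal series here, with \<open>W\<close> for
  \<open>1 / U\<close>. The last two series are \<open>E\<close> and \<open>O\<close>; their
  functions are holomorphic on the disc of radius \<open>1 / 4\<close>.\<close>

lemma usqrt_fps:
  obtains U W :: "complex fps" where
    "U * W = 1" "U ^ 2 + (1 - 8 * fps_X) * W ^ 2 = 3 - 4 * fps_X"
    "fps_nth U 0 = usqrt 0"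
    "fps_conv_radius (3 * U - 5 + (1 - 8 * fps_X) * W + 4 * fps_X) > ereal (1 / 8)"
    "fps_conv_radius (3 - 3 * W - U) > ereal (1 / 8)"
    "eval_fps (3 - 3 * W - U) (1 / 8) = of_real ((30 - 11 * sqrt 10) / 10)"
proof -
  let ?A = "eball 0 (ereal (1 / 4)) :: complex set"
  have A: "?A = ball 0 (1 / 4)"
    by (simp add: set_eq_iff)
  have inv: "(\<lambda>x. 1 / usqrt x) holomorphic_on ?A"
    using usqrt_nonzero by (intro holomorphic_intros usqrt_holomorphic) (auto simp: A)
  define U where "U = fps_expansion usqrt 0"
  define W where "W = fps_expansion (\<lambda>x. 1 / usqrt x) 0"
  have expansion: "f has_fps_expansion fps_expansion f 0" if "f holomorphic_on ?A" for f
    by (rule has_fps_expansion_fps_expansion[OF _ _ that]) (auto simp: A)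
  have U: "usqrt has_fps_expansion U" and W: "(\<lambda>x. 1 / usqrt x) has_fps_expansion W"
    unfolding U_def W_def by (intro expansion usqrt_holomorphic inv)+
  have ev: "\<forall>\<^sub>F x in nhds 0. x \<in> ?A"
    unfolding A by (rule eventually_nhds_in_open) auto
  show ?thesis
  proof
    have "(\<lambda>x. usqrt x * (1 / usqrt x)) has_fps_expansion U * W"
      by (intro fps_expansion_intros U W)
    \<comment> \<open>The pointwise identity holds near 0 because \<open>usqrt\<close> has no zero
      there; uniqueness of the expansion makes it an identity of series.\<close>
    also have "?this \<longleftrightarrow> (\<lambda>x. 1) has_fps_expansion U * W"
      by (intro has_fps_expansion_cong refl eventually_mono[OF ev]) (auto simp: A usqrt_nonzero)
    finally show UW: "U * W = 1"
      by (rule fps_expansion_unique_complex) (rule fps_expansion_intros)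
    have "(\<lambda>x. usqrt x ^ 2 + (1 - 8 * x) * (1 / usqrt x) ^ 2) has_fps_expansion
        U ^ 2 + (1 - 8 * fps_X) * W ^ 2"
      by (intro fps_expansion_intros U W)
    also have "?this \<longleftrightarrow> (\<lambda>x. 3 - 4 * x) has_fps_expansion U ^ 2 + (1 - 8 * fps_X) * W ^ 2"
    proof (intro has_fps_expansion_cong refl eventually_mono[OF ev])
      fix x assume "x \<in> ?A"
      then have "usqrt x \<noteq> 0"
        by (auto simp: A usqrt_nonzero)
      then show "usqrt x ^ 2 + (1 - 8 * x) * (1 / usqrt x) ^ 2 = 3 - 4 * x"
        using usqrt_quartic[of x] by (simp add: divide_simps flip: power_add)
    qed
    finally show "U ^ 2 + (1 - 8 * fps_X) * W ^ 2 = 3 - 4 * fps_X"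
      by (rule fps_expansion_unique_complex) (intro fps_expansion_intros)
    show "fps_nth U 0 = usqrt 0"
      using has_fps_expansion_imp_0_eq_fps_nth_0[OF U] by simp
    let ?E = "\<lambda>x. 3 * usqrt x - 5 + (1 - 8 * x) * (1 / usqrt x) + 4 * x"
    let ?O = "\<lambda>x. 3 - 3 * (1 / usqrt x) - usqrt x"
    have E: "?E holomorphic_on ?A" and O: "?O holomorphic_on ?A"
      by (intro holomorphic_intros usqrt_holomorphic inv)+
    have "?E has_fps_expansion 3 * U - 5 + (1 - 8 * fps_X) * W + 4 * fps_X"
      by (intro fps_expansion_intros U W)
    then have E_eq: "fps_expansion ?E 0 = 3 * U - 5 + (1 - 8 * fps_X) * W + 4 * fps_X"
      by (rule fps_expansion_eqI)
    have "?O has_fps_expansion 3 - 3 * W - U"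
      by (intro fps_expansion_intros U W)
    then have O_eq: "fps_expansion ?O 0 = 3 - 3 * W - U"
      by (rule fps_expansion_eqI)
    have less: "ereal (1 / 8) < ereal (1 / 4)"
      by simp
    show "fps_conv_radius (3 * U - 5 + (1 - 8 * fps_X) * W + 4 * fps_X) > ereal (1 / 8)"
      using conv_radius_fps_expansion[OF E] less unfolding E_eq by (rule less_le_trans[rotated])
    show "fps_conv_radius (3 - 3 * W - U) > ereal (1 / 8)"
      using conv_radius_fps_expansion[OF O] less unfolding O_eq by (rule less_le_trans[rotated])
    have "eval_fps (3 - 3 * W - U) (1 / 8) = ?O (0 + 1 / 8)"
      unfolding O_eq[symmetric] by (rule eval_fps_expansion'[OF O]) auto
    also have "\<dots> = of_real (3 - 3 * (1 / (sqrt 10 / 2)) - sqrt 10 / 2)"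
      by (simp add: usqrt_eighth)
    also have "3 - 3 * (1 / (sqrt 10 / 2)) - sqrt 10 / 2 = (30 - 11 * sqrt 10) / 10"
      by (simp add: field_simps)
    finally show "eval_fps (3 - 3 * W - U) (1 / 8) = of_real ((30 - 11 * sqrt 10) / 10)" .
  qed
qed

section \<open>The series \<open>S\<close> with the dominant singularity\<close>

definition disc_fps :: "complex fps" where
  "disc_fps = 1 - 2 * (row_fps True + row_fps False)"

text \<open>The sum of the two functional equations closes up: \<open>G = T + F\<close> satisfies
  \<open>G = 2 x + G^2\<close>, and completing the square gives the claim.\<close>

lemma disc_fps_square: "disc_fps ^ 2 = 1 - 8 * fps_X"
proof -
  let ?G = "row_fps True + row_fps False"
  have "?G = (fps_X + row_fps False ^ 2 + 2 * row_fps True * row_fps False) + (fps_X + row_fps True ^ 2)"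
    by (rule arg_cong2[OF row_fps_True row_fps_False])
  also have "\<dots> = 2 * fps_X + ?G ^ 2"
    by (simp add: power2_eq_square algebra_simps)
  finally have "?G ^ 2 = ?G - 2 * fps_X"
    by (simp add: algebra_simps)
  moreover have "disc_fps ^ 2 = 1 - 4 * ?G + 4 * ?G ^ 2"
    unfolding disc_fps_def by (simp only: power2_eq_square) (simp add: algebra_simps)
  ultimately have "disc_fps ^ 2 = 1 - 4 * ?G + 4 * (?G - 2 * fps_X)"
    by (simp only:)
  then show ?thesis
    by (simp add: algebra_simps)
qed

lemma disc_fps_nth: "fps_nth disc_fps n = of_real ((1 / 2 gchoose n) * (- 8) ^ n)"
proof -
  have "fps_nth disc_fps n = (1 / 2 gchoose n) * (- 8) ^ n"
  proof (rule fps_sqrt_linear_nth)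
    show "disc_fps ^ 2 = 1 - fps_const 8 * fps_X"
      by (simp add: disc_fps_square flip: numeral_fps_const)
    show "fps_nth disc_fps 0 = 1"
      by (simp add: disc_fps_def row_fps_def row_count_0)
  qed
  also have "\<dots> = of_real ((1 / 2 gchoose n) * (- 8) ^ n)"
    by (simp add: gbinomial_prod_rev)
  finally show ?thesis .
qed

text \<open>The limit 8 places the singularity at \<open>1 / 8\<close>, where \<open>O\<close> has
  to be evaluated.\<close>

lemma disc_fps_ratio: "(\<lambda>n. fps_nth disc_fps (Suc n) / fps_nth disc_fps n) \<longlonglongrightarrow> 8"
proof -
  have "fps_nth disc_fps (Suc n) / fps_nth disc_fps n = of_real ((8 * real n - 4) / (real n + 1))" for n
  proof -
    have "(1 / 2 gchoose Suc n) / (1 / 2 gchoose n) = (1 / 2 - real n) / (real n + 1)"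
      using Suc_gbinomial[of n "1 / 2 :: real"] half_gbinomial_nonzero[of n, where 'a = real]
      by (simp add: field_simps)
    then have "((1 / 2 gchoose Suc n) / (1 / 2 gchoose n)) * (- 8) = (8 * real n - 4) / (real n + 1)"
      by (simp only:) (simp add: field_simps)
    then have "((1 / 2 gchoose Suc n) * (- 8) ^ Suc n) / ((1 / 2 gchoose n) * (- 8) ^ n) =
        (8 * real n - 4) / (real n + 1)"
      by simp
    then show ?thesis
      unfolding disc_fps_nth of_real_divide[symmetric] by simp
  qed
  moreover have "(\<lambda>n. (8 * real n - 4) / (real n + 1)) \<longlonglongrightarrow> 8"
    by real_asymp
  then have "(\<lambda>n. complex_of_real ((8 * real n - 4) / (real n + 1))) \<longlonglongrightarrow> of_real 8"
    by (rule tendsto_of_real)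
  ultimately show ?thesis by simp
qed

text \<open>In \<open>4 T F = E + S O\<close> the coefficients of \<open>E\<close> are negligible
  against those of \<open>S\<close>, while the product \<open>S O\<close> contributes the factor
  \<open>O (1 / 8)\<close>.\<close>

lemma d3_over_disc:
  "(\<lambda>n. real (d3 n) / ((1 / 2 gchoose n) * (- 8) ^ n)) \<longlonglongrightarrow> (30 - 11 * sqrt 10) / 40"
proof -
  obtain U W :: "complex fps" where UW: "U * W = 1"
    and quartic: "U ^ 2 + (1 - 8 * fps_X) * W ^ 2 = 3 - 4 * fps_X"
    and U0: "fps_nth U 0 = usqrt 0"
    and E: "fps_conv_radius (3 * U - 5 + (1 - 8 * fps_X) * W + 4 * fps_X) > ereal (1 / 8)"
    and O: "fps_conv_radius (3 - 3 * W - U) > ereal (1 / 8)"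
    and O_eval: "eval_fps (3 - 3 * W - U) (1 / 8) = of_real ((30 - 11 * sqrt 10) / 10)"
    by (rule usqrt_fps)
  let ?T = "row_fps True" and ?F = "row_fps False" and ?S = disc_fps
  let ?E = "3 * U - 5 + (1 - 8 * fps_X) * W + 4 * fps_X" and ?O = "3 - 3 * W - U"
  have S: "?S = 1 - 2 * ?T - 2 * ?F"
    by (simp add: disc_fps_def algebra_simps)
  have T2: "?T ^ 2 = ?F - fps_X"
    using row_fps_False by simp
  have "(2 * ?T + 1) ^ 2 = 4 * ?T ^ 2 + 4 * ?T + 1"
    by (simp add: power2_eq_square algebra_simps)
  also have "\<dots> = 3 - 4 * fps_X - 2 * ?S"
    unfolding T2 S by (simp add: algebra_simps)
  also have "\<dots> = U ^ 2 + ?S ^ 2 * W ^ 2 - 2 * ?S * (U * W)"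
    by (simp add: UW disc_fps_square quartic)
  also have "\<dots> = (U - ?S * W) ^ 2"
    by (simp add: power2_eq_square algebra_simps)
  finally have "2 * ?T + 1 = U - ?S * W \<or> 2 * ?T + 1 = - (U - ?S * W)"
    by (rule power2_eq_iff[THEN iffD1])
  \<comment> \<open>Constant terms exclude the wrong sign: it would force \<open>W\<close> to start
    with \<open>1 + r\<close>, but \<open>U * W = 1\<close> demands \<open>1 / r\<close>, and
    \<open>r > 1\<close>.\<close>
  moreover have "2 * ?T + 1 \<noteq> - (U - ?S * W)"
  proof
    obtain r where r: "r > 1" "usqrt 0 = of_real r"
      by (rule usqrt_0)
    assume "2 * ?T + 1 = - (U - ?S * W)"
    then have "fps_nth (2 * ?T + 1) 0 = fps_nth (- (U - ?S * W)) 0"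
      by simp
    then have "1 = - (of_real r - fps_nth W 0)"
      using U0 r by (simp add: row_fps_def row_count_0 disc_fps_nth)
    then have "fps_nth W 0 = 1 + of_real r"
      by (simp add: algebra_simps)
    moreover have "of_real r * fps_nth W 0 = 1"
      using arg_cong[OF UW, of "\<lambda>f. fps_nth f 0"] U0 r by simp
    ultimately have "of_real (r * (1 + r)) = complex_of_real 1"
      by simp
    then have "r * (1 + r) = 1"
      by (simp only: of_real_eq_iff)
    moreover have "r * (1 + r) > 1 * 1"
      using r(1) by (intro mult_strict_mono) auto
    ultimately show False by simp
  qed
  ultimately have T: "2 * ?T = U - ?S * W - 1"
    by (simp add: algebra_simps)
  have "4 * (?T * ?F) = ?E + ?S * ?O"
  proof -
    have F: "2 * ?F = 1 - ?S - 2 * ?T"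
      by (simp add: S)
    have "4 * (?T * ?F) = (2 * ?T) * (2 * ?F)"
      by simp
    also have "\<dots> = (2 * ?T) * (1 - ?S) - (2 * ?T) ^ 2"
      unfolding F by (simp add: power2_eq_square algebra_simps)
    also have "\<dots> = (U - ?S * W - 1) * (1 - ?S) - (U - ?S * W - 1) ^ 2"
      by (simp only: T)
    also have "\<dots> = U * 3 - 2 - ?S * W * 3 - ?S * U + ?S ^ 2 * W + ?S - (U ^ 2 + ?S ^ 2 * W ^ 2) + 2 * ?S * (U * W)"
      by (simp add: power2_eq_square algebra_simps)
    \<comment> \<open>Replacing \<open>S^2\<close> by \<open>1 - 8 x\<close> leaves an expression
      linear in \<open>S\<close>, whose two parts are \<open>E\<close> and \<open>O\<close>.\<close>
    also have "\<dots> = ?E + ?S * ?O"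
      unfolding UW disc_fps_square quartic by (simp add: algebra_simps)
    finally show ?thesis .
  qed
  moreover have "4 * of_nat (d3 n) = fps_nth (4 * (?T * ?F)) n" for n
    by (simp add: d3_fps numeral_fps_const)
  ultimately have D: "4 * of_nat (d3 n) = fps_nth ?E n + fps_nth (?S * ?O) n" for n
    by (simp only: fps_add_nth)
  have nz: "fps_nth ?S n \<noteq> 0" for n
    by (simp add: disc_fps_nth half_gbinomial_nonzero)
  have "(\<lambda>n. (fps_nth ?E n / fps_nth ?S n + fps_nth (?S * ?O) n / fps_nth ?S n) / 4) \<longlonglongrightarrow>
      (0 + eval_fps ?O (1 / 8)) / 4"
    by (intro tendsto_intros fps_nth_over_ratio_tendsto_0[OF nz disc_fps_ratio]
        fps_mult_ratio_tendsto[OF nz disc_fps_ratio]) (use E O in simp_all)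
  also have "(\<lambda>n. (fps_nth ?E n / fps_nth ?S n + fps_nth (?S * ?O) n / fps_nth ?S n) / 4) =
      (\<lambda>n. of_real (real (d3 n) / ((1 / 2 gchoose n) * (- 8) ^ n)))"
    unfolding add_divide_distrib[symmetric] D[symmetric] by (simp add: disc_fps_nth)
  also have "(0 + eval_fps ?O (1 / 8)) / 4 = of_real ((30 - 11 * sqrt 10) / 40)"
    unfolding O_eval by simp
  finally show ?thesis
    by (simp only: tendsto_of_real_iff)
qed

theorem theorem7p3:
  shows "(\<lambda>n. real (d3 n)) \<sim>[at_top]
    (\<lambda>n. (11 * sqrt 10 - 30) / 20 * (2 ^ (3 * n - 2) / sqrt (pi * real n ^ 3)))"
proof (rule asymp_equivI')
  let ?s = "\<lambda>n. (1 / 2 gchoose n) * (- 8) ^ n :: real"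
  let ?g = "\<lambda>n. (11 * sqrt 10 - 30) / 20 * (2 ^ (3 * n - 2) / sqrt (pi * real n ^ 3))"
  have "sqrt 10 > 3"
    by (rule real_less_rsqrt) simp
  then have pos: "11 * sqrt 10 - 30 > 0" by simp
  \<comment> \<open>The last factor is the reciprocal of the product of the two limits. Its 80,
    against the 20 in the claim, reflects \<open>8 ^ n = 4 * 2 ^ (3 * n - 2)\<close>, valid for
    \<open>n > 0\<close>.\<close>
  have "(\<lambda>n. (real (d3 n) / ?s n) * (?s n / (8 ^ n / sqrt (real n ^ 3))) * (80 * sqrt pi / (11 * sqrt 10 - 30))) \<longlonglongrightarrow>
      (30 - 11 * sqrt 10) / 40 * (- 1 / (2 * sqrt pi)) * (80 * sqrt pi / (11 * sqrt 10 - 30))"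
    by (intro tendsto_intros d3_over_disc half_gchoose_asymp)
  also have "(30 - 11 * sqrt 10) / 40 * (- 1 / (2 * sqrt pi)) * (80 * sqrt pi / (11 * sqrt 10 - 30)) = 1"
    using pos by (simp add: field_simps)
  finally have lim: "(\<lambda>n. (real (d3 n) / ?s n) * (?s n / (8 ^ n / sqrt (real n ^ 3))) *
      (80 * sqrt pi / (11 * sqrt 10 - 30))) \<longlonglongrightarrow> 1" .
  have "\<forall>\<^sub>F n in sequentially. (real (d3 n) / ?s n) * (?s n / (8 ^ n / sqrt (real n ^ 3))) *
      (80 * sqrt pi / (11 * sqrt 10 - 30)) = real (d3 n) / ?g n"
    using eventually_gt_at_top[of 0]
  proof eventually_elim
    case (elim n)
    have "(8 :: real) ^ n = 2 ^ (3 * n)"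
      by (simp add: power_mult)
    also have "\<dots> = 2 ^ (3 * n - 2 + 2)"
      using elim by (intro arg_cong[where f = "power 2"]) simp
    also have "\<dots> = 4 * 2 ^ (3 * n - 2)"
      by (simp add: power_add)
    finally show ?case
      using pos elim half_gbinomial_nonzero[of n, where 'a = real]
      by (simp add: real_sqrt_mult field_simps)
  qed
  with lim show "(\<lambda>n. real (d3 n) / ?g n) \<longlonglongrightarrow> 1"
    by (rule Lim_transform_eventually)
qed

end
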